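(* Let $m \in \mathbb{N}$, let $(a,b) \subseteq \mathbb{R}^+$, let $\alpha_k \in \mathbb{R}$ and $p_k, q_k \in \mathbb{N}_0$ for $k = 1,\ldots,m$, and let $$f(x) = \sum_{k=1}^{m} \alpha_k x^{p_k} (e^{-x})^{q_k}, \qquad x \in (a,b).$$ For $l_1, \ldots, l_m \in \mathbb{N}$ define the polynomial $$P_{l_1,\ldots,l_m}(x) = \sum_{k=1}^{m} \alpha_k x^{p_k} T_{\vartheta_k}(q_k x), \qquad \vartheta_k = \begin{cases} 2l_k - 1, & \text{if } \alpha_k > 0,\\ 2l_k, & \text{if } \alpha_k < 0. \end{cases}$$ If there exist indices $l_1,\ldots,l_m \in \mathbb{N}$ such that $P_{l_1,\ldots,l_m}(x) > 0$ for all $x \in (a,b)$, then $f(x) > 0$ for all $x \in (a,b)$.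
   Context: $\mathbb{N} = \{1,2,3,\ldots\}$, $\mathbb{N}_0 = \mathbb{N} \cup \{0\}$, $\mathbb{R}^+ = (0,\infty)$. For $n \in \mathbb{N}_0$ and $x\in\mathbb{R}$, $T_n(x) = 1 + \sum_{k=1}^{n} \frac{(-1)^k}{k!} x^k$ denotes the Maclaurin polynomial of order $n$ of the function $e^{-x}$. A function $f$ of the displayed form is called a mixed exponential polynomial (MEP). A term with $\alpha_k = 0$ (for which $\vartheta_k$ is not specified) contributes zero to both $f$ and $P_{l_1,\ldots,l_m}$. *)

theory Defs
  imports "HOL-Analysis.Analysis"
begin

definition maclaurin_exp_neg :: "nat \<Rightarrow> real \<Rightarrow> real" where
  "maclaurin_exp_neg n x = 1 + (\<Sum>k=1..n. (-1) ^ k / fact k * x ^ k)"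

definition mixed_exp_poly ::
    "nat \<Rightarrow> (nat \<Rightarrow> real) \<Rightarrow> (nat \<Rightarrow> nat) \<Rightarrow> (nat \<Rightarrow> nat) \<Rightarrow> real \<Rightarrow> real" where
  "mixed_exp_poly m \<alpha> p q x = (\<Sum>k=1..m. \<alpha> k * x ^ p k * exp (- x) ^ q k)"

(* Only used with l \<ge> 1, so the subtraction on nat does not truncate. The value at
   \<alpha> = 0 is immaterial: there the order belongs to a term with coefficient 0. *)
definition maclaurin_order :: "real \<Rightarrow> nat \<Rightarrow> nat" where
  "maclaurin_order \<alpha> l = (if \<alpha> > 0 then 2 * l - 1 else 2 * l)"

definition mep_minorant ::
    "nat \<Rightarrow> (nat \<Rightarrow> real) \<Rightarrow> (nat \<Rightarrow> nat) \<Rightarrow> (nat \<Rightarrow> nat) \<Rightarrow> (nat \<Rightarrow> nat) \<Rightarrow> real \<Rightarrow> real" where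
  "mep_minorant m \<alpha> p q l x =
     (\<Sum>k=1..m. \<alpha> k * x ^ p k
        * maclaurin_exp_neg (maclaurin_order (\<alpha> k) (l k)) (real (q k) * x))"

end

theory Submission
  imports Defs
begin

text \<open>
  By Taylor's theorem with Lagrange remainder, the order-\<open>n\<close> Maclaurin polynomial of
  \<open>exp (- y)\<close> differs from \<open>exp (- y)\<close> by a term with the sign of \<open>(- y) ^ Suc n\<close>. For
  \<open>y \<ge> 0\<close> the odd-order polynomials therefore lie below \<open>exp (- y)\<close> and the even-order ones
  above it (\<open>maclaurin_exp_neg_le_if_odd\<close>, \<open>maclaurin_exp_neg_ge_if_even\<close>).

  The orders in the minorant are chosen so that replacing \<open>exp (- x) ^ q = exp (- (q * x))\<close> by
  its Maclaurin polynomial can only decrease each term: odd order (a lower bound) where the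
  coefficient is positive, even order (an upper bound) where it is negative. Hence the minorant
  is below the mixed exponential polynomial on the whole half-line \<open>x \<ge> 0\<close>
  (\<open>mep_minorant_le\<close>), and positivity passes from the former to the latter.
\<close>

lemma maclaurin_exp_neg_altdef:
  "maclaurin_exp_neg n x = (\<Sum>k<Suc n. (- x) ^ k / fact k)"
proof -
  have "(\<Sum>k<Suc n. (- x) ^ k / fact k) = 1 + (\<Sum>k=1..n. (- x) ^ k / fact k)"
    by (simp add: sum.lessThan_Suc_shift sum.atLeast1_atMost_eq del: sum.lessThan_Suc)
  also have "(\<Sum>k=1..n. (- x) ^ k / fact k) = (\<Sum>k=1..n. (-1) ^ k / fact k * x ^ k)"
    by (intro sum.cong refl) (subst power_minus, simp)
  finally show ?thesis
    by (simp add: maclaurin_exp_neg_def)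
qed

lemma exp_minus_lagrange_remainder:
  "\<exists>t. exp (- x) = maclaurin_exp_neg n x + exp t / fact (Suc n) * (- x) ^ Suc n"
  using Maclaurin_exp_le[of "- x" "Suc n"] unfolding maclaurin_exp_neg_altdef by blast

lemma maclaurin_exp_neg_le_if_odd:
  assumes "odd n"
  shows "maclaurin_exp_neg n x \<le> exp (- x)"
proof -
  obtain t where "exp (- x) = maclaurin_exp_neg n x + exp t / fact (Suc n) * (- x) ^ Suc n"
    using exp_minus_lagrange_remainder by blast
  moreover have "exp t / fact (Suc n) * (- x) ^ Suc n \<ge> 0"
    using assms by (intro mult_nonneg_nonneg zero_le_even_power) auto
  ultimately show ?thesis by linarith
qed

lemma maclaurin_exp_neg_ge_if_even:
  assumes "even n" and "x \<ge> 0"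
  shows "maclaurin_exp_neg n x \<ge> exp (- x)"
proof -
  obtain t where "exp (- x) = maclaurin_exp_neg n x + exp t / fact (Suc n) * (- x) ^ Suc n"
    using exp_minus_lagrange_remainder by blast
  moreover have "(- x) ^ Suc n \<le> 0"
    using assms by (subst power_minus_odd) auto
  then have "exp t / fact (Suc n) * (- x) ^ Suc n \<le> 0"
    by (intro mult_nonneg_nonpos) auto
  ultimately show ?thesis by linarith
qed

text \<open>
  The condition \<open>l \<ge> 1\<close> guards against truncated subtraction: at \<open>l = 0\<close> the order
  \<open>2 * l - 1\<close> would be \<open>0\<close>, which is even, and the bound for \<open>c > 0\<close> would be reversed.
\<close>
lemma mult_maclaurin_exp_neg_le:
  assumes "l \<ge> 1" and "y \<ge> 0"
  shows "c * maclaurin_exp_neg (maclaurin_order c l) y \<le> c * exp (- y)"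
proof (cases "c > 0")
  case True
  then have "odd (maclaurin_order c l)"
    using assms(1) by (simp add: maclaurin_order_def)
  then show ?thesis
    using True by (simp add: maclaurin_exp_neg_le_if_odd)
next
  case False
  then have "even (maclaurin_order c l)"
    by (simp add: maclaurin_order_def)
  then show ?thesis
    using False assms(2) by (intro mult_left_mono_neg maclaurin_exp_neg_ge_if_even) auto
qed

lemma mep_minorant_le:
  assumes "\<forall>k\<in>{1..m}. l k \<ge> 1" and "x \<ge> 0"
  shows "mep_minorant m \<alpha> p q l x \<le> mixed_exp_poly m \<alpha> p q x"
  unfolding mep_minorant_def mixed_exp_poly_def
proof (rule sum_mono)
  fix k assume "k \<in> {1..m}"
  then have "l k \<ge> 1" using assms(1) by blast
  then have "\<alpha> k * maclaurin_exp_neg (maclaurin_order (\<alpha> k) (l k)) (real (q k) * x)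
      \<le> \<alpha> k * exp (- (real (q k) * x))"
    using assms(2) by (intro mult_maclaurin_exp_neg_le) auto
  also have "exp (- (real (q k) * x)) = exp (- x) ^ q k"
    by (simp flip: exp_of_nat_mult)
  finally have "x ^ p k * (\<alpha> k * maclaurin_exp_neg (maclaurin_order (\<alpha> k) (l k)) (real (q k) * x))
      \<le> x ^ p k * (\<alpha> k * exp (- x) ^ q k)"
    by (rule mult_left_mono) (simp add: assms(2))
  then show "\<alpha> k * x ^ p k * maclaurin_exp_neg (maclaurin_order (\<alpha> k) (l k)) (real (q k) * x)
      \<le> \<alpha> k * x ^ p k * exp (- x) ^ q k"
    by (simp only: mult_ac)
qed

theorem theorem3:
  fixes m :: nat and a b :: ereal and \<alpha> :: "nat \<Rightarrow> real" and p q :: "nat \<Rightarrow> nat"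
  assumes "m \<ge> 1"
    and "einterval a b \<subseteq> {0<..}"
    and "\<exists>l :: nat \<Rightarrow> nat. (\<forall>k\<in>{1..m}. l k \<ge> 1) \<and>
           (\<forall>x\<in>einterval a b. mep_minorant m \<alpha> p q l x > 0)"
  shows "\<forall>x\<in>einterval a b. mixed_exp_poly m \<alpha> p q x > 0"
proof
  fix x assume x: "x \<in> einterval a b"
  obtain l where l: "\<forall>k\<in>{1..m}. l k \<ge> 1"
    and pos: "\<forall>x\<in>einterval a b. mep_minorant m \<alpha> p q l x > 0"
    using assms(3) by blast
  have "x \<ge> 0" using assms(2) x by force
  have "0 < mep_minorant m \<alpha> p q l x" using pos x by blast
  also have "\<dots> \<le> mixed_exp_poly m \<alpha> p q x" using l \<open>x \<ge> 0\<close> by (rule mep_minorant_le)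
  finally show "mixed_exp_poly m \<alpha> p q x > 0" .
qed

end
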